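(* Let $(X,d,\mu)$ be a quasi-metric-measure space and suppose that $\mu$ is integrable in the following sense: for each fixed $r\in(0,\infty)$, the mapping $x\mapsto\mu(B_d(x,r))$ is measurable and $$\int_{X}\frac{1}{\mu(B_d(x,r))}\,d\mu(x)<\infty .$$ Then, for any $\alpha,p\in(0,\infty)$, the embedding $M^{\alpha,p}(X,d,\mu)\hookrightarrow L^p(X,\mu)$ is compact.
   Context: A quasi-metric space $(X,d)$ is a set $X$ with at least two elements and a function $d:X\times X\to[0,\infty)$ for which there are constants $C_0,C_1\in(0,\infty)$ such that for all $x,y,z\in X$: $d(x,y)=0$ iff $x=y$; $d(y,x)\le C_0 d(x,y)$; $d(x,y)\le C_1\max\{d(x,z),d(z,y)\}$ (symmetry is not required). Balls are $B_d(x,r):=\{y\in X:d(x,y)<r\}$. The topology $\tau_d$ consists of all $\mathcal O\subseteq X$ such that for each $x\in\mathcal O$ there is $r>0$ with $B_d(x,r)\subseteq\mathcal O$. A quasi-metric-measure space $(X,d,\mu)$ is a quasi-metric space with a nonnegative measure $\mu$ on a $\sigma$-algebra containing the Borel sets of $\tau_d$, such that all $d$-balls are measurable and $\mu(B_d(x,r))\in(0,\infty)$ for all $x\in X$, $r\in(0,\infty)$. Hajłasz–Sobolev space: for $\alpha,p\in(0,\infty)$ and measurable $u:X\to\mathbb R$, $\mathcal D_d^\alpha(u)$ is the set of nonnegative measurable functions $g$ on $X$ for which there is a measurable $E\subseteq X$ with $\mu(E)=0$ and $|u(x)-u(y)|\le[d(x,y)]^\alpha(g(x)+g(y))$ for all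 $x,y\in X\setminus E$. $M^{\alpha,p}(X,d,\mu)$ is the set of $u\in L^p(X,\mu)$ with finite (quasi-)norm $\|u\|_{L^p(X,\mu)}+\inf_{g\in\mathcal D_d^\alpha(u)}\|g\|_{L^p(X,\mu)}$. The embedding being compact means that the natural inclusion map is well defined and maps bounded sets to totally bounded (equivalently, relatively compact) sets. *)

theory Defs
  imports "HOL-Analysis.Analysis"
begin

definition qball :: "'a set \<Rightarrow> ('a \<Rightarrow> 'a \<Rightarrow> real) \<Rightarrow> 'a \<Rightarrow> real \<Rightarrow> 'a set" where
  "qball X d x r = {y \<in> X. d x y < r}"

definition qtopology :: "'a set \<Rightarrow> ('a \<Rightarrow> 'a \<Rightarrow> real) \<Rightarrow> 'a topology" where
  "qtopology X d = topology (\<lambda>U. U \<subseteq> X \<and> (\<forall>x\<in>U. \<exists>r>0. qball X d x r \<subseteq> U))"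

lemma openin_qtopology:
  "openin (qtopology X d) U \<longleftrightarrow> U \<subseteq> X \<and> (\<forall>x\<in>U. \<exists>r>0. qball X d x r \<subseteq> U)"
proof -
  have "istopology (\<lambda>U. U \<subseteq> X \<and> (\<forall>x\<in>U. \<exists>r>0. qball X d x r \<subseteq> U))"
    unfolding istopology_def
  proof (intro conjI allI impI)
    fix S T
    assume S: "S \<subseteq> X \<and> (\<forall>x\<in>S. \<exists>r>0. qball X d x r \<subseteq> S)"
      and T: "T \<subseteq> X \<and> (\<forall>x\<in>T. \<exists>r>0. qball X d x r \<subseteq> T)"
    show "S \<inter> T \<subseteq> X" using S by blast
    show "\<forall>x\<in>S \<inter> T. \<exists>r>0. qball X d x r \<subseteq> S \<inter> T"
    proof
      fix x assume "x \<in> S \<inter> T"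
      then obtain r s where "r > 0" "qball X d x r \<subseteq> S" "s > 0" "qball X d x s \<subseteq> T"
        using S T by blast
      then have "min r s > 0 \<and> qball X d x (min r s) \<subseteq> S \<inter> T"
        by (auto simp: qball_def)
      then show "\<exists>r>0. qball X d x r \<subseteq> S \<inter> T" by blast
    qed
  next
    fix K
    assume K: "\<forall>U\<in>K. U \<subseteq> X \<and> (\<forall>x\<in>U. \<exists>r>0. qball X d x r \<subseteq> U)"
    then show "\<Union>K \<subseteq> X" by blast
    show "\<forall>x\<in>\<Union>K. \<exists>r>0. qball X d x r \<subseteq> \<Union>K"
      using K by (meson Union_iff Union_upper subset_trans)
  qed
  then show ?thesis by (simp add: qtopology_def topology_inverse')
qed

locale quasi_metric_space =
  fixes X :: "'a set" and d :: "'a \<Rightarrow> 'a \<Rightarrow> real"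
  assumes two_points: "\<exists>x\<in>X. \<exists>y\<in>X. x \<noteq> y"
    and nonneg: "\<And>x y. x \<in> X \<Longrightarrow> y \<in> X \<Longrightarrow> 0 \<le> d x y"
    and zero_iff: "\<And>x y. x \<in> X \<Longrightarrow> y \<in> X \<Longrightarrow> d x y = 0 \<longleftrightarrow> x = y"
    and quasi_sym: "\<exists>C0>0. \<forall>x\<in>X. \<forall>y\<in>X. d y x \<le> C0 * d x y"
    and quasi_triangle: "\<exists>C1>0. \<forall>x\<in>X. \<forall>y\<in>X. \<forall>z\<in>X. d x y \<le> C1 * max (d x z) (d z y)"

text \<open>The Borel sets are only required to be contained in \<^term>\<open>sets M\<close>; the measure need not
  be complete, and balls need not be open.\<close>

locale quasi_metric_measure_space = quasi_metric_space "space M" d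
  for M :: "'a measure" and d :: "'a \<Rightarrow> 'a \<Rightarrow> real" +
  assumes borel_subset: "sigma_sets (space M) {U. openin (qtopology (space M) d) U} \<subseteq> sets M"
    and ball_measurable: "\<And>x r. x \<in> space M \<Longrightarrow> qball (space M) d x r \<in> sets M"
    and ball_pos: "\<And>x r. x \<in> space M \<Longrightarrow> 0 < r \<Longrightarrow> 0 < emeasure M (qball (space M) d x r)"
    and ball_finite: "\<And>x r. x \<in> space M \<Longrightarrow> 0 < r \<Longrightarrow> emeasure M (qball (space M) d x r) < \<infinity>"

text \<open>Function spaces are represented by sets of functions rather than of almost-everywhere
  classes; the values of a function off \<^term>\<open>space M\<close> are irrelevant. For \<open>0 < p < 1\<close> the
  functional \<open>Lp_norm\<close> is only a quasi-norm.\<close>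

definition Lp_norm :: "'a measure \<Rightarrow> real \<Rightarrow> ('a \<Rightarrow> real) \<Rightarrow> ennreal" where
  "Lp_norm M p u =
     (let I = (\<integral>\<^sup>+ x. ennreal (\<bar>u x\<bar> powr p) \<partial>M)
      in if I = \<infinity> then \<infinity> else ennreal (enn2real I powr (1 / p)))"

definition Lp_space :: "'a measure \<Rightarrow> real \<Rightarrow> ('a \<Rightarrow> real) set" where
  "Lp_space M p = {u \<in> borel_measurable M. Lp_norm M p u < \<infinity>}"

definition hajlasz_gradients ::
    "'a measure \<Rightarrow> ('a \<Rightarrow> 'a \<Rightarrow> real) \<Rightarrow> real \<Rightarrow> ('a \<Rightarrow> real) \<Rightarrow> ('a \<Rightarrow> real) set" where
  "hajlasz_gradients M d \<alpha> u =
     {g \<in> borel_measurable M. (\<forall>x\<in>space M. 0 \<le> g x) \<and>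
        (\<exists>E\<in>null_sets M. \<forall>x\<in>space M - E. \<forall>y\<in>space M - E.
           \<bar>u x - u y\<bar> \<le> d x y powr \<alpha> * (g x + g y))}"

text \<open>The infimum is \<open>\<infinity>\<close> if there is no gradient.\<close>

definition hajlasz_norm ::
    "'a measure \<Rightarrow> ('a \<Rightarrow> 'a \<Rightarrow> real) \<Rightarrow> real \<Rightarrow> real \<Rightarrow> ('a \<Rightarrow> real) \<Rightarrow> ennreal" where
  "hajlasz_norm M d \<alpha> p u =
     Lp_norm M p u + (INF g \<in> hajlasz_gradients M d \<alpha> u. Lp_norm M p g)"

definition hajlasz_space ::
    "'a measure \<Rightarrow> ('a \<Rightarrow> 'a \<Rightarrow> real) \<Rightarrow> real \<Rightarrow> real \<Rightarrow> ('a \<Rightarrow> real) set" where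
  "hajlasz_space M d \<alpha> p = {u \<in> Lp_space M p. hajlasz_norm M d \<alpha> p u < \<infinity>}"

definition qnorm_bounded :: "(('a \<Rightarrow> real) \<Rightarrow> ennreal) \<Rightarrow> ('a \<Rightarrow> real) set \<Rightarrow> bool" where
  "qnorm_bounded N S \<longleftrightarrow> (\<exists>R::real. \<forall>u\<in>S. N u \<le> ennreal R)"

definition qnorm_totally_bounded :: "(('a \<Rightarrow> real) \<Rightarrow> ennreal) \<Rightarrow> ('a \<Rightarrow> real) set \<Rightarrow> bool" where
  "qnorm_totally_bounded N S \<longleftrightarrow>
     (\<forall>\<epsilon>::real. \<epsilon> > 0 \<longrightarrow>
        (\<exists>K. finite K \<and> K \<subseteq> S \<and> (\<forall>u\<in>S. \<exists>v\<in>K. N (\<lambda>x. u x - v x) < ennreal \<epsilon>)))"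

text \<open>The second conjunct says that the inclusion respects the identification of functions at
  distance zero, so that it descends to almost-everywhere classes.\<close>

definition compact_embedding ::
    "('a \<Rightarrow> real) set \<Rightarrow> (('a \<Rightarrow> real) \<Rightarrow> ennreal) \<Rightarrow>
     ('a \<Rightarrow> real) set \<Rightarrow> (('a \<Rightarrow> real) \<Rightarrow> ennreal) \<Rightarrow> bool" where
  "compact_embedding V NV W NW \<longleftrightarrow>
     V \<subseteq> W \<and>
     (\<forall>u\<in>V. \<forall>v\<in>V. NV (\<lambda>x. u x - v x) = 0 \<longrightarrow> NW (\<lambda>x. u x - v x) = 0) \<and>
     (\<forall>S. S \<subseteq> V \<longrightarrow> qnorm_bounded NV S \<longrightarrow> qnorm_totally_bounded NW S)"

end

theory Submission
  imports Defs
begin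

text \<open>Write \<open>w\<^sub>r x = 1 / \<mu> (B (x, r))\<close> and \<open>\<nu> = w\<^sub>r \<mu>\<close>, a finite measure by hypothesis. Let \<open>u\<close>
  have a gradient \<open>g\<close>, with the integrals of \<open>\<bar>u\<bar>\<^sup>p\<close> and \<open>g\<^sup>p\<close> at most \<open>A\<close>. The gradient
  inequality compares \<open>u x\<close> with \<open>u y\<close> for every \<open>y\<close> in \<open>B (x, r)\<close>; averaging its \<open>p\<close>-th power over
  such \<open>y\<close> gives, for \<open>r \<le> 1\<close> and almost every \<open>x\<close>,
  \<open>\<bar>u x\<bar>\<^sup>p \<le> C r\<^bsup>\<alpha>p\<^esup> g(x)\<^sup>p + C A w\<^sub>r x\<close>
  with \<open>C\<close> depending on \<open>p\<close> only (\<open>hajlasz_pointwise_bound\<close>). Hence the integral of \<open>\<bar>u\<bar>\<^sup>p\<close> over a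
  set \<open>F\<close> is at most \<open>C A r\<^bsup>\<alpha>p\<^esup> + C A \<nu> F\<close>: after fixing a small \<open>r\<close>, the mass of all functions in a
  bounded family is small on every set of small \<open>\<nu>\<close>-measure (\<open>hajlasz_equi_integrable\<close>). This
  controls at once the escape of mass to infinity and its concentration on small sets.

  It remains to approximate the family uniformly off a set \<open>F\<close> of small \<open>\<nu>\<close>-measure, where \<open>F\<close> may
  depend on the functions compared. Up to small \<open>\<nu>\<close>-measure the space is a set \<open>Y\<close> on which \<open>w\<^sub>r\<close> lies
  between \<open>1/k\<close> and \<open>k\<close>; there \<open>\<mu> Y\<close> is finite and \<open>\<nu> \<le> k \<mu>\<close> (\<open>weight_truncation\<close>). By Markov's
  inequality, \<open>u\<close> and \<open>g\<close> are bounded by a large \<open>L\<close> off a set of small \<open>\<mu>\<close>-measure, so that \<open>u\<close> is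
  Hoelder continuous with constant \<open>2 L\<close> on the remaining set \<open>G u\<close>. As balls have positive finite
  measure, finitely many sets of small diameter cover the space up to small \<open>\<nu>\<close>-measure
  (\<open>finite_small_cover\<close>). On each of them \<open>u\<close> is nearly constant inside \<open>G u\<close>, and recording its
  values up to rounding leaves finitely many possibilities (\<open>finite_net_of_small_oscillation\<close>). Two
  functions with the same record are uniformly close on the good part of \<open>Y\<close>, and their difference
  has small mass on the rest. In place of the triangle inequality for the norm, which
  fails if \<open>p < 1\<close>, the inequality \<open>(a + b)\<^sup>p \<le> 2\<^sup>p (a\<^sup>p + b\<^sup>p)\<close> serves for all \<open>p > 0\<close>.\<close>

section \<open>Powers and the \<open>L\<^sup>p\<close> functional\<close>

lemma powr_add_le:
  fixes a b p :: real
  assumes "0 \<le> a" "0 \<le> b" "0 < p"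
  shows "(a + b) powr p \<le> 2 powr p * (a powr p + b powr p)"
proof -
  have "(a + b) powr p \<le> (2 * max a b) powr p"
    using assms by (intro powr_mono2) auto
  also have "\<dots> = 2 powr p * max a b powr p"
    using assms by (simp add: powr_mult)
  also have "max a b powr p \<le> a powr p + b powr p"
    by (auto simp: max_def)
  finally show ?thesis by simp
qed

lemma Lp_norm_less:
  assumes "0 < p" "0 < \<epsilon>" "(\<integral>\<^sup>+ x. ennreal (\<bar>u x\<bar> powr p) \<partial>M) < ennreal (\<epsilon> powr p)"
  shows "Lp_norm M p u < ennreal \<epsilon>"
proof -
  obtain t where t: "0 \<le> t" "(\<integral>\<^sup>+ x. ennreal (\<bar>u x\<bar> powr p) \<partial>M) = ennreal t"
    using assms(3) by (cases "\<integral>\<^sup>+ x. ennreal (\<bar>u x\<bar> powr p) \<partial>M") auto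
  have "t < \<epsilon> powr p" using assms(3) t by (simp add: ennreal_less_iff)
  then have "t powr (1 / p) < (\<epsilon> powr p) powr (1 / p)"
    using t assms by (intro powr_less_mono2) auto
  then have "t powr (1 / p) < \<epsilon>" using assms by (simp add: powr_powr)
  then show ?thesis using t by (simp add: Lp_norm_def ennreal_less_iff)
qed

lemma nn_integral_powr_le_of_Lp_norm_le:
  assumes "0 < p" "0 \<le> R" "Lp_norm M p u \<le> ennreal R"
  shows "(\<integral>\<^sup>+ x. ennreal (\<bar>u x\<bar> powr p) \<partial>M) \<le> ennreal (R powr p)"
proof (cases "\<integral>\<^sup>+ x. ennreal (\<bar>u x\<bar> powr p) \<partial>M")
  case (real t)
  then have "t powr (1 / p) \<le> R" using assms by (simp add: Lp_norm_def)
  then have "(t powr (1 / p)) powr p \<le> R powr p"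
    using assms by (intro powr_mono2) auto
  then show ?thesis using real assms by (simp add: powr_powr ennreal_leI)
next
  case top
  then show ?thesis using assms by (simp add: Lp_norm_def top_unique)
qed

section \<open>Measures with an integrable weight\<close>

text \<open>The sets where \<open>1 / n \<le> w \<le> n\<close> increase to the whole space, so their complements tend to measure
  zero for the finite measure \<open>w M\<close>. The upper bound on \<open>w\<close> makes \<open>w M\<close> dominated by \<open>M\<close> there, and the
  lower bound makes the set of finite \<open>M\<close>-measure by Markov's inequality.\<close>

lemma weight_truncation:
  fixes w :: "'a \<Rightarrow> ennreal"
  assumes w [measurable]: "w \<in> borel_measurable M" and fin: "(\<integral>\<^sup>+ x. w x \<partial>M) < \<infinity>"
    and pos: "\<And>x. x \<in> space M \<Longrightarrow> 0 < w x" and lt: "\<And>x. x \<in> space M \<Longrightarrow> w x < \<infinity>"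
    and "0 < \<delta>"
  obtains Y k where "Y \<in> sets M" "emeasure M Y < \<infinity>" "0 < k"
    "emeasure (density M w) (space M - Y) < ennreal \<delta>"
    "\<And>G. G \<in> sets M \<Longrightarrow> emeasure (density M w) (Y \<inter> G) \<le> ennreal k * emeasure M G"
proof -
  define Y where "Y n = {x \<in> space M. 1 \<le> of_nat (Suc n) * w x \<and> w x \<le> of_nat (Suc n)}" for n
  have Ym [measurable]: "Y n \<in> sets M" for n unfolding Y_def by measurable
  have "(\<lambda>n. emeasure (density M w) (space M - Y n)) \<longlonglongrightarrow>
          emeasure (density M w) (\<Inter>n. space M - Y n)"
  proof (rule Lim_emeasure_decseq)
    show "range (\<lambda>n. space M - Y n) \<subseteq> sets (density M w)" by auto
    have "Y n \<subseteq> Y (Suc n)" for n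
    proof
      fix x assume x: "x \<in> Y n"
      have le: "(of_nat (Suc n) :: ennreal) \<le> of_nat (Suc (Suc n))"
        by (simp only: of_nat_le_iff)
      have "of_nat (Suc n) * w x \<le> of_nat (Suc (Suc n)) * w x"
        by (rule mult_right_mono[OF le]) simp
      then show "x \<in> Y (Suc n)" using x le unfolding Y_def by (blast intro: order_trans)
    qed
    then show "decseq (\<lambda>n. space M - Y n)" unfolding decseq_Suc_iff by blast
    fix i
    have "emeasure (density M w) (space M - Y i) \<le> emeasure (density M w) (space M)"
      by (intro emeasure_mono) auto
    also have "\<dots> = (\<integral>\<^sup>+ x. w x \<partial>M)"
      by (simp add: emeasure_density cong: nn_integral_cong)
    finally show "emeasure (density M w) (space M - Y i) \<noteq> \<infinity>" using fin by auto
  qed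
  also have "(\<Inter>n. space M - Y n) = {}"
  proof -
    have "\<exists>n. x \<in> Y n" if x: "x \<in> space M" for x
    proof -
      obtain a where a: "0 < a" "w x = ennreal a"
        using pos[OF x] lt[OF x] by (cases "w x") auto
      obtain n where n: "max a (1 / a) \<le> real n" using real_arch_simple by blast
      have "1 \<le> real (Suc n) * a" "a \<le> real (Suc n)"
        using n a by (auto simp: field_simps) 
      then have "ennreal 1 \<le> ennreal (real (Suc n) * a)" "ennreal a \<le> ennreal (real (Suc n))"
        by (simp_all only: ennreal_leI)
      moreover have "ennreal (real (Suc n) * a) = of_nat (Suc n) * w x"
        using a by (simp only: ennreal_of_nat_eq_real_of_nat ennreal_mult of_nat_0_le_iff less_imp_le)
      ultimately have "x \<in> Y n" using a x
        by (simp only: Y_def ennreal_of_nat_eq_real_of_nat ennreal_1 mem_Collect_eq simp_thms)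
      then show ?thesis ..
    qed
    then show ?thesis by blast
  qed
  finally have "(\<lambda>n. emeasure (density M w) (space M - Y n)) \<longlonglongrightarrow> 0" by simp
  then have "\<forall>\<^sub>F n in sequentially. emeasure (density M w) (space M - Y n) < ennreal \<delta>"
    using \<open>0 < \<delta>\<close> by (intro order_tendstoD) auto
  then obtain n where n: "emeasure (density M w) (space M - Y n) < ennreal \<delta>"
    by (auto simp: eventually_sequentially)
  have "emeasure M (Y n) = (\<integral>\<^sup>+ x. indicator (Y n) x \<partial>M)" by simp
  also have "\<dots> \<le> (\<integral>\<^sup>+ x. of_nat (Suc n) * w x \<partial>M)"
    by (intro nn_integral_mono) (auto simp: Y_def split: split_indicator)
  also have "\<dots> = of_nat (Suc n) * (\<integral>\<^sup>+ x. w x \<partial>M)" by (rule nn_integral_cmult) simp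
  also have "\<dots> < \<infinity>" using fin by (simp add: ennreal_mult_less_top of_nat_less_top)
  finally have Yfin: "emeasure M (Y n) < \<infinity>" .
  have le: "emeasure (density M w) (Y n \<inter> G) \<le> ennreal (real (Suc n)) * emeasure M G"
    if [measurable]: "G \<in> sets M" for G
  proof -
    have "emeasure (density M w) (Y n \<inter> G) = (\<integral>\<^sup>+ x. w x * indicator (Y n \<inter> G) x \<partial>M)"
      by (simp add: emeasure_density)
    also have "\<dots> \<le> (\<integral>\<^sup>+ x. of_nat (Suc n) * indicator G x \<partial>M)"
      by (intro nn_integral_mono) (auto simp: Y_def split: split_indicator)
    also have "\<dots> = of_nat (Suc n) * emeasure M G"
      by (subst nn_integral_cmult_indicator) auto
    finally show ?thesis by (simp only: ennreal_of_nat_eq_real_of_nat)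
  qed
  show thesis by (rule that[OF Ym Yfin _ n le]) auto
qed

text \<open>All finite sums of the measures are bounded by the total mass, and a summable family has only
  countably many nonzero terms.\<close>

lemma countable_disjoint_positive_measure:
  assumes "finite_measure \<nu>" "disjoint_family_on B T"
    and meas: "\<And>t. t \<in> T \<Longrightarrow> B t \<in> sets \<nu>"
    and pos: "\<And>t. t \<in> T \<Longrightarrow> 0 < emeasure \<nu> (B t)"
  shows "countable T"
proof -
  interpret finite_measure \<nu> by fact
  have "(\<lambda>t. measure \<nu> (B t)) summable_on T"
  proof (rule nonneg_bdd_above_summable_on)
    show "bdd_above (sum (\<lambda>t. measure \<nu> (B t)) ` {F. F \<subseteq> T \<and> finite F})"
    proof (rule bdd_aboveI2)
      fix F assume F: "F \<in> {F. F \<subseteq> T \<and> finite F}"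
      have "(\<Sum>t\<in>F. measure \<nu> (B t)) = measure \<nu> (\<Union>t\<in>F. B t)"
        using F meas assms(2)
        by (intro finite_measure_finite_Union[symmetric]) (auto intro: disjoint_family_on_mono)
      also have "\<dots> \<le> measure \<nu> (space \<nu>)" by (rule bounded_measure)
      finally show "(\<Sum>t\<in>F. measure \<nu> (B t)) \<le> measure \<nu> (space \<nu>)" .
    qed
  qed auto
  then have "countable {t \<in> T. measure \<nu> (B t) \<noteq> 0}"
    using summable_countable_real by blast
  moreover have "{t \<in> T. measure \<nu> (B t) \<noteq> 0} = T"
    using pos by (fastforce simp: emeasure_eq_measure)
  ultimately show ?thesis by simp
qed

lemma emeasure_abs_gt_le:
  assumes [measurable]: "f \<in> borel_measurable M" and "0 < p" "0 < L" "0 \<le> A"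
    and fA: "(\<integral>\<^sup>+ x. ennreal (\<bar>f x\<bar> powr p) \<partial>M) \<le> ennreal A"
  shows "emeasure M {x \<in> space M. L < \<bar>f x\<bar>} \<le> ennreal (A / L powr p)"
proof -
  have "emeasure M {x \<in> space M. L < \<bar>f x\<bar>} = (\<integral>\<^sup>+ x. indicator {x \<in> space M. L < \<bar>f x\<bar>} x \<partial>M)"
    by (simp add: nn_integral_indicator)
  also have "\<dots> \<le> (\<integral>\<^sup>+ x. ennreal (1 / L powr p) * ennreal (\<bar>f x\<bar> powr p) \<partial>M)"
  proof (intro nn_integral_mono)
    fix x
    have "1 \<le> 1 / L powr p * \<bar>f x\<bar> powr p" if "L < \<bar>f x\<bar>"
      using powr_mono2[of p L "\<bar>f x\<bar>"] that assms by simp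
    then show "indicator {x \<in> space M. L < \<bar>f x\<bar>} x
        \<le> ennreal (1 / L powr p) * ennreal (\<bar>f x\<bar> powr p)"
      by (auto simp: indicator_def simp flip: ennreal_mult'')
  qed
  also have "\<dots> = ennreal (1 / L powr p) * (\<integral>\<^sup>+ x. ennreal (\<bar>f x\<bar> powr p) \<partial>M)"
    by (rule nn_integral_cmult) simp
  also have "\<dots> \<le> ennreal (1 / L powr p) * ennreal A"
    using fA by (rule mult_left_mono) simp
  finally show ?thesis using \<open>0 \<le> A\<close> by (simp flip: ennreal_mult)
qed

section \<open>A finite net from rounded values\<close>

text \<open>Up to an error of \<open>2 * \<eta>\<close>, a function \<open>u\<close> is determined on \<open>G u\<close> by its code: the set of all
  pairs of a cell and a rounded value that \<open>u\<close> takes in this cell inside \<open>G u\<close>. There are finitely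
  many codes, because the values are bounded, so one representative of each code suffices.
  Each \<open>u\<close> has its own good set \<open>G u\<close>; comparing sets of values, rather than a value at a chosen
  point, handles cells that miss \<open>G u\<close>.\<close>

lemma finite_net_of_small_oscillation:
  fixes G :: "('a \<Rightarrow> real) \<Rightarrow> 'a set"
  assumes "finite \<Q>" "0 < \<eta>"
    and bound: "\<And>u x. u \<in> S \<Longrightarrow> x \<in> G u \<Longrightarrow> \<bar>u x\<bar> \<le> L"
    and osc: "\<And>u Q x y. u \<in> S \<Longrightarrow> Q \<in> \<Q> \<Longrightarrow> x \<in> Q \<inter> G u \<Longrightarrow> y \<in> Q \<inter> G u \<Longrightarrow> \<bar>u x - u y\<bar> \<le> \<eta>"
  obtains K where "finite K" "K \<subseteq> S"
    "\<And>u. u \<in> S \<Longrightarrow> \<exists>v\<in>K. \<forall>x\<in>\<Union>\<Q> \<inter> G u \<inter> G v. \<bar>u x - v x\<bar> \<le> 2 * \<eta>"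
proof -
  define code where "code u = {(Q, \<lfloor>u x / \<eta>\<rfloor>) | Q x. Q \<in> \<Q> \<and> x \<in> Q \<inter> G u}" for u
  have "code u \<subseteq> \<Q> \<times> {\<lfloor>- L / \<eta>\<rfloor>..\<lfloor>L / \<eta>\<rfloor>}" if u: "u \<in> S" for u
  proof -
    have "- L / \<eta> \<le> u x / \<eta>" "u x / \<eta> \<le> L / \<eta>" if "x \<in> G u" for x
      using bound[OF u that] \<open>0 < \<eta>\<close> by (intro divide_right_mono; simp)+
    then show ?thesis unfolding code_def by (auto intro!: floor_mono)
  qed
  then have "code ` S \<subseteq> Pow (\<Q> \<times> {\<lfloor>- L / \<eta>\<rfloor>..\<lfloor>L / \<eta>\<rfloor>})" by blast
  then have "finite (code ` S)"
    by (rule finite_subset) (simp add: \<open>finite \<Q>\<close>)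
  from finite_subset_image[OF this order_refl]
  obtain K where K: "K \<subseteq> S" "finite K" "code ` S = code ` K" by auto
  show thesis
  proof (rule that[OF K(2,1)])
    fix u assume u: "u \<in> S"
    then obtain v where v: "v \<in> K" "code u = code v" using K(3) by blast
    have "\<bar>u x - v x\<bar> \<le> 2 * \<eta>" if x: "x \<in> \<Union>\<Q> \<inter> G u \<inter> G v" for x
    proof -
      obtain Q where Q: "Q \<in> \<Q>" "x \<in> Q" using x by blast
      \<comment> \<open>By equality of the codes, \<open>v\<close> takes nearly the value \<open>u x\<close> somewhere in the cell of \<open>x\<close>.\<close>
      have "(Q, \<lfloor>u x / \<eta>\<rfloor>) \<in> code v"
        using Q x v(2)[symmetric] by (auto simp: code_def)
      then obtain y where y: "y \<in> Q \<inter> G v" "\<lfloor>u x / \<eta>\<rfloor> = \<lfloor>v y / \<eta>\<rfloor>"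
        by (auto simp: code_def)
      then have "\<bar>u x / \<eta> - v y / \<eta>\<bar> < 1" by linarith
      then have "\<bar>u x - v y\<bar> < \<eta>" using \<open>0 < \<eta>\<close>
        by (simp add: diff_divide_distrib[symmetric] abs_divide)
      moreover have "\<bar>v x - v y\<bar> \<le> \<eta>" using osc[of v Q x y] v(1) K(1) Q x y by blast
      ultimately show ?thesis by linarith
    qed
    then show "\<exists>v\<in>K. \<forall>x\<in>\<Union>\<Q> \<inter> G u \<inter> G v. \<bar>u x - v x\<bar> \<le> 2 * \<eta>" using v by blast
  qed
qed

section \<open>Covering by finitely many small sets up to small measure\<close>

context quasi_metric_measure_space
begin

text \<open>The centres of a maximal family of disjoint balls of radius \<open>\<rho>\<close> form a countable set, since the
  balls have positive measure for the finite measure \<open>\<nu>\<close>. By maximality every ball of radius \<open>\<rho>\<close>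
  meets one of them, so the balls with the same centres and a larger radius \<open>s\<close> cover the space;
  continuity of \<open>\<nu>\<close> leaves finitely many of them up to measure \<open>\<delta>\<close>.\<close>

lemma finite_small_cover:
  assumes "finite_measure \<nu>" and sets: "sets \<nu> = sets M"
    and pos: "\<And>x r. x \<in> space M \<Longrightarrow> 0 < r \<Longrightarrow> 0 < emeasure \<nu> (qball (space M) d x r)"
    and "0 < D" "0 < \<delta>"
  obtains \<Q> where "finite \<Q>" "\<Q> \<subseteq> sets M"
    "\<And>Q x y. Q \<in> \<Q> \<Longrightarrow> x \<in> Q \<Longrightarrow> y \<in> Q \<Longrightarrow> d x y \<le> D"
    "emeasure \<nu> (space M - \<Union>\<Q>) < ennreal \<delta>"
proof -
  interpret \<nu>: finite_measure \<nu> by fact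
  let ?B = "qball (space M) d"
  obtain C0 where C0: "0 < C0" "\<And>x y. x \<in> space M \<Longrightarrow> y \<in> space M \<Longrightarrow> d y x \<le> C0 * d x y"
    using quasi_sym by blast
  obtain C1 where C1: "0 < C1"
    "\<And>x y z. x \<in> space M \<Longrightarrow> y \<in> space M \<Longrightarrow> z \<in> space M \<Longrightarrow> d x y \<le> C1 * max (d x z) (d z y)"
    using quasi_triangle by blast
  define c where "c = C1 * max 1 C0"
  have c: "0 < c" using C1 C0 by (simp add: c_def)
  have meet: "d x y \<le> c * \<rho>" if "x \<in> space M" "y \<in> space M" "z \<in> space M"
      "d x z \<le> \<rho>" "d y z \<le> \<rho>" for x y z \<rho>
  proof -
    have "0 \<le> \<rho>" using nonneg[of x z] that by simp
    have "d z y \<le> C0 * \<rho>"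
      using C0(2)[of y z] that C0(1) by (meson mult_left_mono order_trans less_imp_le)
    also have "\<dots> \<le> max 1 C0 * \<rho>" using \<open>0 \<le> \<rho>\<close> by (intro mult_right_mono) auto
    finally have "d z y \<le> max 1 C0 * \<rho>" .
    moreover have "d x z \<le> max 1 C0 * \<rho>"
      using that \<open>0 \<le> \<rho>\<close> mult_right_mono[of 1 "max 1 C0" \<rho>] by simp
    ultimately have "C1 * max (d x z) (d z y) \<le> C1 * (max 1 C0 * \<rho>)"
      using C1(1) by (intro mult_left_mono) auto
    then show ?thesis using C1(2)[of x y z] that by (simp add: c_def mult.assoc)
  qed
  have sym: "d y x \<le> max 1 C0 * \<rho>" if "x \<in> space M" "y \<in> space M" "d x y \<le> \<rho>" for x y \<rho>
  proof -
    have "d y x \<le> C0 * d x y" using C0(2) that by blast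
    also have "\<dots> \<le> max 1 C0 * \<rho>" using that nonneg C0(1) by (intro mult_mono) auto
    finally show ?thesis .
  qed
  \<comment> \<open>By \<open>sym\<close> and \<open>meet\<close>, a ball of radius \<open>s\<close> has diameter at most \<open>c * (max 1 C0 * s) = D\<close>; by
    \<open>meet\<close>, centres of intersecting balls of radius \<open>\<rho>\<close> have distance at most \<open>c * \<rho> < s\<close>.\<close>
  define s where "s = D / (c * max 1 C0)"
  define \<rho> where "\<rho> = s / (2 * c)"
  have s: "0 < s" "c * (max 1 C0 * s) = D"
    using c \<open>0 < D\<close> by (auto simp: s_def)
  have \<rho>: "0 < \<rho>" "c * \<rho> < s" using c s by (auto simp: \<rho>_def)
  let ?P = "{T. T \<subseteq> space M \<and> disjoint_family_on (\<lambda>t. ?B t \<rho>) T}"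
  have "\<exists>T\<in>?P. \<forall>S\<in>?P. T \<subseteq> S \<longrightarrow> S = T"
  proof (rule subset_Zorn')
    fix \<C> assume C: "subset.chain ?P \<C>"
    have "disjoint_family_on (\<lambda>t. ?B t \<rho>) (\<Union>\<C>)"
      unfolding disjoint_family_on_def
    proof (intro ballI impI)
      fix a b assume "a \<in> \<Union>\<C>" "b \<in> \<Union>\<C>" "a \<noteq> b"
      then obtain S where "S \<in> \<C>" "a \<in> S" "b \<in> S"
        using C unfolding subset_chain_def by blast
      then show "?B a \<rho> \<inter> ?B b \<rho> = {}"
        using C \<open>a \<noteq> b\<close> unfolding subset_chain_def disjoint_family_on_def by blast
    qed
    then show "\<Union>\<C> \<in> ?P" using C unfolding subset_chain_def by blast
  qed
  then obtain T where TP: "T \<in> ?P" and max: "\<forall>S\<in>?P. T \<subseteq> S \<longrightarrow> S = T" by (rule bexE)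
  then have T: "T \<subseteq> space M" "disjoint_family_on (\<lambda>t. ?B t \<rho>) T" by simp_all
  have "countable T"
    using T pos \<rho> ball_measurable
    by (intro countable_disjoint_positive_measure[OF \<open>finite_measure \<nu>\<close> T(2)])
       (auto simp: sets subset_eq)
  have cover: "\<exists>t\<in>T. x \<in> ?B t s" if x: "x \<in> space M" for x
  proof (cases "x \<in> T")
    case True
    then show ?thesis using s x zero_iff[OF x x] by (intro bexI[of _ x]) (auto simp: qball_def)
  next
    case False
    have "\<exists>t\<in>T. ?B x \<rho> \<inter> ?B t \<rho> \<noteq> {}"
    proof (rule ccontr)
      assume "\<not> ?thesis"
      then have "insert x T \<in> ?P"
        using T x by (auto simp: disjoint_family_on_def)
      from bspec[OF max this] show False using False by blast
    qed
    then obtain t z where "t \<in> T" "z \<in> space M" "d x z < \<rho>" "d t z < \<rho>"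
      by (auto simp: qball_def)
    then have "d t x \<le> c * \<rho>" using meet[of t x z \<rho>] x T by auto
    then show ?thesis using \<open>t \<in> T\<close> \<rho> x by (intro bexI[of _ t]) (auto simp: qball_def)
  qed
  have "T \<noteq> {}" using cover two_points by blast
  define t where "t = from_nat_into T"
  have t: "range t = T" unfolding t_def using \<open>countable T\<close> \<open>T \<noteq> {}\<close> by (simp add: range_from_nat_into)
  have tX: "t i \<in> space M" for i using t T by auto
  have "(\<lambda>n. emeasure \<nu> (space M - (\<Union>i<n. ?B (t i) s))) \<longlonglongrightarrow>
          emeasure \<nu> (\<Inter>n. space M - (\<Union>i<n. ?B (t i) s))"
  proof (rule Lim_emeasure_decseq)
    have "(\<Union>i<n. ?B (t i) s) \<in> sets M" for n
      using tX ball_measurable by (intro sets.finite_UN) auto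
    then show "range (\<lambda>n. space M - (\<Union>i<n. ?B (t i) s)) \<subseteq> sets \<nu>"
      by (auto simp: sets)
    show "decseq (\<lambda>n. space M - (\<Union>i<n. ?B (t i) s))"
      unfolding decseq_Suc_iff by (auto simp: lessThan_Suc)
  qed (simp add: \<nu>.emeasure_eq_measure)
  also have "(\<Inter>n. space M - (\<Union>i<n. ?B (t i) s)) = {}"
    using cover t by (force simp: image_iff)
  finally have "(\<lambda>n. emeasure \<nu> (space M - (\<Union>i<n. ?B (t i) s))) \<longlonglongrightarrow> 0" by simp
  then have "\<forall>\<^sub>F n in sequentially. emeasure \<nu> (space M - (\<Union>i<n. ?B (t i) s)) < ennreal \<delta>"
    using \<open>0 < \<delta>\<close> by (intro order_tendstoD) auto
  then obtain n where n: "emeasure \<nu> (space M - (\<Union>i<n. ?B (t i) s)) < ennreal \<delta>"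
    by (auto simp: eventually_sequentially)
  show thesis
  proof (rule that[of "(\<lambda>i. ?B (t i) s) ` {..<n}"])
    fix Q x y assume "Q \<in> (\<lambda>i. ?B (t i) s) ` {..<n}" "x \<in> Q" "y \<in> Q"
    then obtain i where "x \<in> ?B (t i) s" "y \<in> ?B (t i) s" by blast
    then have i: "x \<in> space M" "y \<in> space M" "d (t i) x \<le> s" "d (t i) y \<le> s"
      by (auto simp: qball_def)
    show "d x y \<le> D"
      using meet[OF i(1,2) tX sym[OF tX i(1,3)] sym[OF tX i(2,4)]] s by simp
  qed (use n tX ball_measurable in auto)
qed

section \<open>Equi-integrability\<close>

definition inverse_ball_measure :: "real \<Rightarrow> 'a \<Rightarrow> ennreal" where
  "inverse_ball_measure r x = 1 / emeasure M (qball (space M) d x r)"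

lemma inverse_ball_measure_bounds:
  assumes "x \<in> space M" "0 < r"
  shows "0 < inverse_ball_measure r x" "inverse_ball_measure r x < \<infinity>"
proof -
  obtain b where b: "0 < b" "emeasure M (qball (space M) d x r) = ennreal b"
    using ball_pos[OF assms] ball_finite[OF assms]
    by (cases "emeasure M (qball (space M) d x r)") auto
  then have "inverse_ball_measure r x = ennreal (1 / b)"
    by (simp add: inverse_ball_measure_def divide_ennreal flip: ennreal_1)
  then show "0 < inverse_ball_measure r x" "inverse_ball_measure r x < \<infinity>"
    using b by simp_all
qed

text \<open>For \<open>y\<close> in the ball of radius \<open>r\<close> about \<open>x\<close>, off the exceptional set, the gradient inequality
  gives \<open>\<bar>u x\<bar> \<le> r\<^bsup>\<alpha>\<^esup> g x + (\<bar>u y\<bar> + g y)\<close>; the claim is the average over \<open>y\<close> of its \<open>p\<close>-th power. The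
  small factor is kept on \<open>g x\<close>, whereas the terms in \<open>y\<close> cost no more than a multiple of the weight.\<close>

lemma hajlasz_pointwise_bound:
  assumes [measurable]: "u \<in> borel_measurable M" "g \<in> borel_measurable M"
    and g0: "\<And>x. x \<in> space M \<Longrightarrow> 0 \<le> g x" and N: "N \<in> null_sets M"
    and grad: "\<And>x y. x \<in> space M - N \<Longrightarrow> y \<in> space M - N \<Longrightarrow>
                 \<bar>u x - u y\<bar> \<le> d x y powr \<alpha> * (g x + g y)"
    and uA: "(\<integral>\<^sup>+ x. ennreal (\<bar>u x\<bar> powr p) \<partial>M) \<le> ennreal A"
    and gA: "(\<integral>\<^sup>+ x. ennreal (\<bar>g x\<bar> powr p) \<partial>M) \<le> ennreal A"
    and "0 \<le> A" "0 < r" "r \<le> 1" "0 < \<alpha>" "0 < p" and x: "x \<in> space M - N"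
  shows "ennreal (\<bar>u x\<bar> powr p) \<le>
           ennreal (2 powr p * r powr (\<alpha> * p)) * ennreal (\<bar>g x\<bar> powr p)
           + ennreal (4 powr p * (2 * A)) * inverse_ball_measure r x"
proof -
  let ?B = "qball (space M) d x r"
  have xX: "x \<in> space M" using x by auto
  obtain b where b: "0 < b" "emeasure M ?B = ennreal b"
    using ball_pos[OF xX \<open>0 < r\<close>] ball_finite[OF xX \<open>0 < r\<close>]
    by (cases "emeasure M ?B") auto
  have [measurable]: "?B \<in> sets M" using ball_measurable xX by blast
  define c1 where "c1 = 2 powr p * r powr (\<alpha> * p) * \<bar>g x\<bar> powr p"
  have c1: "0 \<le> c1" by (simp add: c1_def)
  have pt: "\<bar>u x\<bar> powr p \<le> c1 + 4 powr p * (\<bar>u y\<bar> powr p + \<bar>g y\<bar> powr p)"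
    if y: "y \<in> ?B" "y \<notin> N" for y
  proof -
    have yX: "y \<in> space M" and dy: "d x y < r" using y by (auto simp: qball_def)
    have ra: "r powr \<alpha> \<le> 1" using \<open>0 < r\<close> \<open>r \<le> 1\<close> \<open>0 < \<alpha>\<close> by (intro powr_le1) auto
    have "\<bar>u x - u y\<bar> \<le> d x y powr \<alpha> * (g x + g y)" using grad x y yX by blast
    also have "\<dots> \<le> r powr \<alpha> * (g x + g y)"
      using dy nonneg[OF xX yX] g0[OF xX] g0[OF yX] \<open>0 < \<alpha>\<close>
      by (intro mult_right_mono powr_mono2) auto
    also have "\<dots> \<le> r powr \<alpha> * g x + g y"
      using mult_right_mono[OF ra g0[OF yX]] by (simp add: distrib_left)
    finally have "\<bar>u x\<bar> \<le> r powr \<alpha> * \<bar>g x\<bar> + (\<bar>u y\<bar> + \<bar>g y\<bar>)"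
      using g0[OF xX] g0[OF yX] by simp
    then have "\<bar>u x\<bar> powr p \<le> (r powr \<alpha> * \<bar>g x\<bar> + (\<bar>u y\<bar> + \<bar>g y\<bar>)) powr p"
      using \<open>0 < p\<close> by (intro powr_mono2) auto
    also have "\<dots> \<le> 2 powr p * ((r powr \<alpha> * \<bar>g x\<bar>) powr p + (\<bar>u y\<bar> + \<bar>g y\<bar>) powr p)"
      using \<open>0 < p\<close> by (intro powr_add_le) auto
    also have "\<dots> \<le> 2 powr p * ((r powr \<alpha> * \<bar>g x\<bar>) powr p
                    + 2 powr p * (\<bar>u y\<bar> powr p + \<bar>g y\<bar> powr p))"
      using \<open>0 < p\<close> by (intro mult_left_mono add_left_mono powr_add_le) auto
    also have "\<dots> = c1 + (2 powr p * 2 powr p) * (\<bar>u y\<bar> powr p + \<bar>g y\<bar> powr p)"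
      by (simp add: c1_def powr_mult powr_powr algebra_simps)
    also have "(2::real) powr p * 2 powr p = 4 powr p"
      by (simp flip: powr_mult)
    finally show ?thesis .
  qed
  have "ennreal (\<bar>u x\<bar> powr p) * ennreal b = (\<integral>\<^sup>+ y. ennreal (\<bar>u x\<bar> powr p) * indicator ?B y \<partial>M)"
    by (simp add: nn_integral_cmult_indicator b)
  also have "\<dots> \<le> (\<integral>\<^sup>+ y. ennreal c1 * indicator ?B y
      + ennreal (4 powr p) * (ennreal (\<bar>u y\<bar> powr p) + ennreal (\<bar>g y\<bar> powr p)) \<partial>M)"
  proof (rule nn_integral_mono_AE)
    show "AE y in M. ennreal (\<bar>u x\<bar> powr p) * indicator ?B y \<le> ennreal c1 * indicator ?B y
      + ennreal (4 powr p) * (ennreal (\<bar>u y\<bar> powr p) + ennreal (\<bar>g y\<bar> powr p))"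
      using AE_not_in[OF N]
    proof eventually_elim
      case (elim y)
      show ?case
      proof (cases "y \<in> ?B")
        case True
        then have "ennreal (\<bar>u x\<bar> powr p)
            \<le> ennreal (c1 + 4 powr p * (\<bar>u y\<bar> powr p + \<bar>g y\<bar> powr p))"
          using pt elim by (intro ennreal_leI) auto
        also have "\<dots> = ennreal c1
            + ennreal (4 powr p) * (ennreal (\<bar>u y\<bar> powr p) + ennreal (\<bar>g y\<bar> powr p))"
          using c1 by (simp add: ennreal_plus ennreal_mult)
        finally show ?thesis using True by simp
      qed simp
    qed
  qed
  also have "\<dots> = ennreal c1 * ennreal b + ennreal (4 powr p) *
      ((\<integral>\<^sup>+ y. ennreal (\<bar>u y\<bar> powr p) \<partial>M) + (\<integral>\<^sup>+ y. ennreal (\<bar>g y\<bar> powr p) \<partial>M))"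
    by (simp add: nn_integral_add nn_integral_cmult nn_integral_cmult_indicator b)
  also have "\<dots> \<le> ennreal c1 * ennreal b + ennreal (4 powr p) * (ennreal A + ennreal A)"
    using uA gA by (intro add_left_mono mult_left_mono add_mono) auto
  also have "\<dots> = ennreal (c1 * b + 4 powr p * (2 * A))"
    using c1 b \<open>0 \<le> A\<close> by (simp add: ennreal_plus ennreal_mult flip: mult_2)
  finally have "ennreal (\<bar>u x\<bar> powr p * b) \<le> ennreal (c1 * b + 4 powr p * (2 * A))"
    using b by (subst ennreal_mult) auto
  then have "\<bar>u x\<bar> powr p * b \<le> c1 * b + 4 powr p * (2 * A)"
    using b c1 \<open>0 \<le> A\<close> by (subst (asm) ennreal_le_iff) auto
  then have "\<bar>u x\<bar> powr p \<le> c1 + 4 powr p * (2 * A) * (1 / b)"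
    using b by (simp add: field_simps)
  then have "ennreal (\<bar>u x\<bar> powr p) \<le> ennreal (c1 + 4 powr p * (2 * A) * (1 / b))"
    by (rule ennreal_leI)
  also have "\<dots> = ennreal c1 + ennreal (4 powr p * (2 * A)) * ennreal (1 / b)"
    using b c1 \<open>0 \<le> A\<close>
    by (subst ennreal_plus; (subst ennreal_mult)?) (auto intro!: divide_nonneg_pos)
  also have "ennreal (1 / b) = inverse_ball_measure r x"
    using b by (simp add: inverse_ball_measure_def divide_ennreal flip: ennreal_1)
  also have "ennreal c1 = ennreal (2 powr p * r powr (\<alpha> * p)) * ennreal (\<bar>g x\<bar> powr p)"
    by (simp add: c1_def ennreal_mult)
  finally show ?thesis .
qed

text \<open>The first summand is independent of \<open>F\<close> and small with \<open>r\<close>. Since the weight depends on \<open>r\<close>, a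
  small \<open>F\<close> has to be chosen after \<open>r\<close>.\<close>

lemma hajlasz_equi_integrable:
  assumes [measurable]: "u \<in> borel_measurable M" "g \<in> borel_measurable M"
    and w [measurable]: "inverse_ball_measure r \<in> borel_measurable M"
    and g0: "\<And>x. x \<in> space M \<Longrightarrow> 0 \<le> g x" and N: "N \<in> null_sets M"
    and grad: "\<And>x y. x \<in> space M - N \<Longrightarrow> y \<in> space M - N \<Longrightarrow>
                 \<bar>u x - u y\<bar> \<le> d x y powr \<alpha> * (g x + g y)"
    and uA: "(\<integral>\<^sup>+ x. ennreal (\<bar>u x\<bar> powr p) \<partial>M) \<le> ennreal A"
    and gA: "(\<integral>\<^sup>+ x. ennreal (\<bar>g x\<bar> powr p) \<partial>M) \<le> ennreal A"
    and "0 \<le> A" "0 < r" "r \<le> 1" "0 < \<alpha>" "0 < p" and F [measurable]: "F \<in> sets M"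
  shows "(\<integral>\<^sup>+ x. ennreal (\<bar>u x\<bar> powr p) * indicator F x \<partial>M) \<le>
           ennreal (2 powr p * r powr (\<alpha> * p) * A)
           + ennreal (4 powr p * (2 * A)) * emeasure (density M (inverse_ball_measure r)) F"
proof -
  have "(\<integral>\<^sup>+ x. ennreal (\<bar>u x\<bar> powr p) * indicator F x \<partial>M) \<le>
    (\<integral>\<^sup>+ x. ennreal (2 powr p * r powr (\<alpha> * p)) * ennreal (\<bar>g x\<bar> powr p)
           + ennreal (4 powr p * (2 * A)) * (inverse_ball_measure r x * indicator F x) \<partial>M)"
  proof (rule nn_integral_mono_AE)
    show "AE x in M. ennreal (\<bar>u x\<bar> powr p) * indicator F x \<le>
      ennreal (2 powr p * r powr (\<alpha> * p)) * ennreal (\<bar>g x\<bar> powr p)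
           + ennreal (4 powr p * (2 * A)) * (inverse_ball_measure r x * indicator F x)"
      using AE_not_in[OF N] AE_space
    proof eventually_elim
      case (elim x)
      then have "x \<in> space M - N" by simp
      from hajlasz_pointwise_bound[OF assms(1,2) g0 N grad uA gA \<open>0 \<le> A\<close> \<open>0 < r\<close> \<open>r \<le> 1\<close>
          \<open>0 < \<alpha>\<close> \<open>0 < p\<close> this]
      show ?case by (cases "x \<in> F") simp_all
    qed
  qed
  also have "\<dots> = ennreal (2 powr p * r powr (\<alpha> * p)) * (\<integral>\<^sup>+ x. ennreal (\<bar>g x\<bar> powr p) \<partial>M)
    + ennreal (4 powr p * (2 * A)) * emeasure (density M (inverse_ball_measure r)) F"
    by (simp add: nn_integral_add nn_integral_cmult emeasure_density)
  also have "\<dots> \<le> ennreal (2 powr p * r powr (\<alpha> * p)) * ennreal A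
    + ennreal (4 powr p * (2 * A)) * emeasure (density M (inverse_ball_measure r)) F"
    using gA by (intro add_right_mono mult_left_mono) auto
  finally show ?thesis using \<open>0 \<le> A\<close> by (simp add: ennreal_mult)
qed

section \<open>Total boundedness\<close>

text \<open>The parameters are chosen in the order \<open>r\<close>, \<open>\<delta>\<close>, \<open>Y\<close> and \<open>k\<close>, \<open>L\<close>, \<open>\<theta>\<close>, \<open>D\<close>. The bound on the distance
  of two functions with equal codes has three parts, each made smaller than \<open>e\<close>: the part from
  \<open>r\<close>, the part from the \<open>\<nu>\<close>-measure (at most \<open>4 * \<delta>\<close>) of the bad set, and the uniform error \<open>\<theta>\<close>
  on \<open>Y\<close>. Fixing \<open>Y\<close> before the cover is what keeps the third part small, since \<open>\<theta>\<close> has to be small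
  relative to the \<open>M\<close>-measure of the good set.\<close>

lemma uniform_hajlasz_totally_bounded:
  fixes g :: "('a \<Rightarrow> real) \<Rightarrow> 'a \<Rightarrow> real" and N :: "('a \<Rightarrow> real) \<Rightarrow> 'a set"
  assumes w: "\<And>r. 0 < r \<Longrightarrow> inverse_ball_measure r \<in> borel_measurable M"
    and w_fin: "\<And>r. 0 < r \<Longrightarrow> (\<integral>\<^sup>+ x. inverse_ball_measure r x \<partial>M) < \<infinity>"
    and "0 < \<alpha>" "0 < p" "0 \<le> A"
    and u_meas: "\<And>u. u \<in> S \<Longrightarrow> u \<in> borel_measurable M"
    and g_meas: "\<And>u. u \<in> S \<Longrightarrow> g u \<in> borel_measurable M"
    and g0: "\<And>u x. u \<in> S \<Longrightarrow> x \<in> space M \<Longrightarrow> 0 \<le> g u x"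
    and N: "\<And>u. u \<in> S \<Longrightarrow> N u \<in> null_sets M"
    and grad: "\<And>u x y. u \<in> S \<Longrightarrow> x \<in> space M - N u \<Longrightarrow> y \<in> space M - N u \<Longrightarrow>
                 \<bar>u x - u y\<bar> \<le> d x y powr \<alpha> * (g u x + g u y)"
    and uA: "\<And>u. u \<in> S \<Longrightarrow> (\<integral>\<^sup>+ x. ennreal (\<bar>u x\<bar> powr p) \<partial>M) \<le> ennreal A"
    and gA: "\<And>u. u \<in> S \<Longrightarrow> (\<integral>\<^sup>+ x. ennreal (\<bar>g u x\<bar> powr p) \<partial>M) \<le> ennreal A"
  shows "qnorm_totally_bounded (Lp_norm M p) S"
  unfolding qnorm_totally_bounded_def
proof (intro allI impI)
  fix \<epsilon> :: real assume "0 < \<epsilon>"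
  define e where "e = \<epsilon> powr p / 3"
  have e: "0 < e" using \<open>0 < \<epsilon>\<close> by (simp add: e_def)
  \<comment> \<open>Both the tails of \<open>u\<close> and of \<open>v\<close> enter, each with the factor \<open>2 powr p\<close> from \<open>powr_add_le\<close>.\<close>
  define K1 where "K1 = 2 powr p * 2 * 2 powr p * A"
  define K2 where "K2 = 2 powr p * 2 * (4 powr p * (2 * A))"
  have K: "0 \<le> K1" "0 \<le> K2" using \<open>0 \<le> A\<close> by (simp_all add: K1_def K2_def)
  define r where "r = min 1 ((e / (K1 + 1)) powr (1 / (\<alpha> * p)))"
  have r: "0 < r" "r \<le> 1" using e K by (auto simp: r_def)
  have r_small: "K1 * r powr (\<alpha> * p) < e"
  proof -
    have "r powr (\<alpha> * p) \<le> ((e / (K1 + 1)) powr (1 / (\<alpha> * p))) powr (\<alpha> * p)"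
      using r \<open>0 < \<alpha>\<close> \<open>0 < p\<close> by (intro powr_mono2) (auto simp: r_def)
    also have "\<dots> = e / (K1 + 1)" using e K \<open>0 < \<alpha>\<close> \<open>0 < p\<close> by (simp add: powr_powr)
    finally have "K1 * r powr (\<alpha> * p) \<le> K1 * (e / (K1 + 1))"
      using K by (intro mult_left_mono) auto
    also have "\<dots> < e" using e K by (simp add: field_simps)
    finally show ?thesis .
  qed
  define \<delta> where "\<delta> = e / (4 * (K2 + 1))"
  have \<delta>: "0 < \<delta>" "K2 * (4 * \<delta>) < e"
    using e K by (auto simp: \<delta>_def field_simps)
  have [measurable]: "inverse_ball_measure r \<in> borel_measurable M" using w r by blast
  define \<nu> where "\<nu> = density M (inverse_ball_measure r)"
  have sets_\<nu>: "sets \<nu> = sets M" by (simp add: \<nu>_def)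
  have fin_\<nu>: "finite_measure \<nu>"
  proof (rule finite_measureI)
    have "emeasure \<nu> (space \<nu>) = (\<integral>\<^sup>+ x. inverse_ball_measure r x \<partial>M)"
      by (simp add: \<nu>_def emeasure_density cong: nn_integral_cong)
    then show "emeasure \<nu> (space \<nu>) \<noteq> \<infinity>" using w_fin[OF r(1)] by auto
  qed
  have pos_\<nu>: "0 < emeasure \<nu> (qball (space M) d x s)" if "x \<in> space M" "0 < s" for x s
  proof (rule ccontr)
    let ?B = "qball (space M) d x s"
    have B: "?B \<in> sets M" using ball_measurable that by blast
    assume "\<not> 0 < emeasure \<nu> ?B"
    then have "?B \<in> null_sets \<nu>" using B by (simp add: null_setsI sets_\<nu>)
    then have "AE y in M. y \<in> ?B \<longrightarrow> inverse_ball_measure r y = 0"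
      by (simp add: \<nu>_def null_sets_density_iff)
    then have "AE y in M. y \<notin> ?B"
      using AE_space
    proof eventually_elim
      case (elim y)
      then show ?case using inverse_ball_measure_bounds(1)[of y r] r by auto
    qed
    then have "?B \<in> null_sets M" using B by (simp add: AE_iff_null_sets)
    then show False using ball_pos[OF that] by auto
  qed
  obtain Y k where Y [measurable]: "Y \<in> sets M" and Yfin: "emeasure M Y < \<infinity>" and k: "0 < k"
    and Yc: "emeasure \<nu> (space M - Y) < ennreal \<delta>"
    and Yk: "\<And>G. G \<in> sets M \<Longrightarrow> emeasure \<nu> (Y \<inter> G) \<le> ennreal k * emeasure M G"
    using weight_truncation[of "inverse_ball_measure r" M \<delta>] w[OF r(1)] w_fin[OF r(1)]
      inverse_ball_measure_bounds r(1) \<delta>(1) unfolding \<nu>_def by blast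
  obtain m where m: "0 \<le> m" "emeasure M Y = ennreal m"
    using Yfin by (cases "emeasure M Y") auto
  define L where "L = (2 * k * A / \<delta> + 1) powr (1 / p)"
  have L: "0 < L" "k * (2 * A / L powr p) \<le> \<delta>"
  proof -
    have pos: "0 < 2 * k * A / \<delta> + 1"
      using k \<delta> \<open>0 \<le> A\<close> by (intro add_nonneg_pos) auto
    then show "0 < L" by (simp add: L_def)
    have "L powr p = 2 * k * A / \<delta> + 1"
      using pos \<open>0 < p\<close> by (simp add: L_def powr_powr)
    then show "k * (2 * A / L powr p) \<le> \<delta>"
      using pos \<delta> by (simp add: pos_divide_le_eq) (simp add: field_simps)
  qed
  define \<theta> where "\<theta> = (e / (m + 1)) powr (1 / p)"
  have \<theta>: "0 < \<theta>" "\<theta> powr p * m < e"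
  proof -
    show "0 < \<theta>" using e m by (simp add: \<theta>_def)
    have "\<theta> powr p = e / (m + 1)" using e m \<open>0 < p\<close> by (simp add: \<theta>_def powr_powr)
    moreover have "e / (m + 1) * m < e" using e m(1) by (simp add: pos_divide_less_eq)
    ultimately show "\<theta> powr p * m < e" by simp
  qed
  define D where "D = (\<theta> / (4 * L)) powr (1 / \<alpha>)"
  have D: "0 < D" "D powr \<alpha> * (2 * L) = \<theta> / 2"
    using \<theta> L \<open>0 < \<alpha>\<close> by (auto simp: D_def powr_powr)
  obtain \<Q> where Q: "finite \<Q>" "\<Q> \<subseteq> sets M"
    "\<And>Q x y. Q \<in> \<Q> \<Longrightarrow> x \<in> Q \<Longrightarrow> y \<in> Q \<Longrightarrow> d x y \<le> D"
    "emeasure \<nu> (space M - \<Union>\<Q>) < ennreal \<delta>"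
    using finite_small_cover[OF fin_\<nu> sets_\<nu> pos_\<nu> D(1) \<delta>(1)] by blast
  have [measurable]: "\<Union>\<Q> \<in> sets M" using Q by (intro sets.finite_Union) auto
  define G where "G u = {x \<in> space M - N u. \<bar>u x\<bar> \<le> L \<and> \<bar>g u x\<bar> \<le> L}" for u
  have G_meas: "G u \<in> sets M" if "u \<in> S" for u
  proof -
    have [measurable]: "u \<in> borel_measurable M" "g u \<in> borel_measurable M" "N u \<in> sets M"
      using u_meas g_meas N that by auto
    have "G u = {x \<in> space M. \<bar>u x\<bar> \<le> L \<and> \<bar>g u x\<bar> \<le> L} - N u" by (auto simp: G_def)
    also have "\<dots> \<in> sets M" by measurable
    finally show ?thesis .
  qed
  have G_small: "emeasure \<nu> (Y \<inter> (space M - G u)) \<le> ennreal \<delta>" if u: "u \<in> S" for u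
  proof -
    have [measurable]: "u \<in> borel_measurable M" "g u \<in> borel_measurable M" "N u \<in> sets M"
      using u_meas g_meas N that by auto
    let ?U = "{x \<in> space M. L < \<bar>u x\<bar>}" and ?V = "{x \<in> space M. L < \<bar>g u x\<bar>}"
    have "emeasure M (space M - G u) \<le> emeasure M (N u \<union> (?U \<union> ?V))"
      by (intro emeasure_mono) (auto simp: G_def)
    also have "\<dots> = emeasure M (?U \<union> ?V)"
      using N[OF u] by (subst Un_commute, intro emeasure_Un_null_set) auto
    also have "\<dots> \<le> emeasure M ?U + emeasure M ?V"
      by (intro emeasure_subadditive) auto
    also have "\<dots> \<le> ennreal (A / L powr p) + ennreal (A / L powr p)"
      using u uA gA L \<open>0 < p\<close> \<open>0 \<le> A\<close> by (intro add_mono emeasure_abs_gt_le) auto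
    also have "\<dots> = ennreal (2 * A / L powr p)"
      using \<open>0 \<le> A\<close> by (simp flip: ennreal_plus)
    finally have "ennreal k * emeasure M (space M - G u) \<le> ennreal k * ennreal (2 * A / L powr p)"
      by (intro mult_left_mono) auto
    also have "\<dots> = ennreal (k * (2 * A / L powr p))"
      using k \<open>0 \<le> A\<close> by (intro ennreal_mult[symmetric]) auto
    also have "\<dots> \<le> ennreal \<delta>" using L by (intro ennreal_leI)
    finally show ?thesis using Yk[of "space M - G u"] G_meas[OF u] by (auto intro: order_trans)
  qed
  obtain K where net: "finite K" "K \<subseteq> S"
    "\<And>u. u \<in> S \<Longrightarrow> \<exists>v\<in>K. \<forall>x\<in>\<Union>\<Q> \<inter> G u \<inter> G v. \<bar>u x - v x\<bar> \<le> 2 * (\<theta> / 2)"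
  proof (rule finite_net_of_small_oscillation[of \<Q> "\<theta> / 2" S G L])
    fix u Q x y assume u: "u \<in> S" and QQ: "Q \<in> \<Q>" and x: "x \<in> Q \<inter> G u" and y: "y \<in> Q \<inter> G u"
    have xy: "x \<in> space M - N u" "y \<in> space M - N u" using x y by (auto simp: G_def)
    have "\<bar>u x - u y\<bar> \<le> d x y powr \<alpha> * (g u x + g u y)" by (rule grad[OF u xy])
    also have "\<dots> \<le> D powr \<alpha> * (2 * L)"
      using Q(3)[OF QQ] x y xy nonneg g0[OF u] \<open>0 < \<alpha>\<close>
      by (intro mult_mono powr_mono2) (auto simp: G_def)
    finally show "\<bar>u x - u y\<bar> \<le> \<theta> / 2" using D by simp
  qed (use Q \<theta> in \<open>auto simp: G_def\<close>)
  have Lp_close: "Lp_norm M p (\<lambda>x. u x - v x) < ennreal \<epsilon>"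
    if u: "u \<in> S" and v: "v \<in> S"
      and close: "\<And>x. x \<in> \<Union>\<Q> \<inter> G u \<inter> G v \<Longrightarrow> \<bar>u x - v x\<bar> \<le> \<theta>" for u v
  proof (rule Lp_norm_less[OF \<open>0 < p\<close> \<open>0 < \<epsilon>\<close>])
    have [measurable]: "u \<in> borel_measurable M" "v \<in> borel_measurable M"
      "G u \<in> sets M" "G v \<in> sets M" using u_meas G_meas u v by auto
    \<comment> \<open>\<open>F\<close> is the bad set: one of the four conditions in its complement fails, at cost \<open>\<delta>\<close> each.\<close>
    define F where "F = space M - (Y \<inter> (\<Union>\<Q> \<inter> G u \<inter> G v))"
    have [measurable]: "F \<in> sets M" unfolding F_def by measurable
    have "emeasure \<nu> F \<le> emeasure \<nu> (((space M - Y) \<union> (space M - \<Union>\<Q>))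
        \<union> ((Y \<inter> (space M - G u)) \<union> (Y \<inter> (space M - G v))))"
      by (intro emeasure_mono) (auto simp: F_def sets_\<nu>)
    also have "\<dots> \<le> (emeasure \<nu> (space M - Y) + emeasure \<nu> (space M - \<Union>\<Q>))
        + (emeasure \<nu> (Y \<inter> (space M - G u)) + emeasure \<nu> (Y \<inter> (space M - G v)))"
      by (intro order_trans[OF emeasure_subadditive] add_mono emeasure_subadditive)
         (auto simp: sets_\<nu>)
    also have "\<dots> \<le> (ennreal \<delta> + ennreal \<delta>) + (ennreal \<delta> + ennreal \<delta>)"
      using Yc Q(4) G_small u v by (intro add_mono) auto
    also have "\<dots> = ennreal (4 * \<delta>)" using \<delta> by (simp flip: ennreal_plus)
    finally have F: "emeasure \<nu> F \<le> ennreal (4 * \<delta>)" .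
    define E where "E = 2 powr p * r powr (\<alpha> * p) * A + 4 powr p * (2 * A) * (4 * \<delta>)"
    have E0: "0 \<le> E" using \<open>0 \<le> A\<close> \<delta> by (simp add: E_def)
    have tail: "(\<integral>\<^sup>+ x. ennreal (\<bar>f x\<bar> powr p) * indicator F x \<partial>M) \<le> ennreal E" if f: "f \<in> S" for f
    proof -
      have "(\<integral>\<^sup>+ x. ennreal (\<bar>f x\<bar> powr p) * indicator F x \<partial>M) \<le>
           ennreal (2 powr p * r powr (\<alpha> * p) * A) + ennreal (4 powr p * (2 * A)) * emeasure \<nu> F"
        unfolding \<nu>_def
        by (rule hajlasz_equi_integrable[where g = "g f" and N = "N f"])
           (use f u_meas g_meas g0 N grad uA gA r \<open>0 \<le> A\<close> \<open>0 < \<alpha>\<close> \<open>0 < p\<close> in auto)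
      also have "\<dots> \<le> ennreal (2 powr p * r powr (\<alpha> * p) * A)
          + ennreal (4 powr p * (2 * A)) * ennreal (4 * \<delta>)"
        using F by (intro add_left_mono mult_left_mono) auto
      also have "\<dots> = ennreal E"
        unfolding E_def using \<open>0 \<le> A\<close> \<delta>
          ennreal_mult[of "4 powr p * (2 * A)" "4 * \<delta>"] by (subst ennreal_plus) auto
      finally show ?thesis .
    qed
    have "(\<integral>\<^sup>+ x. ennreal (\<bar>u x - v x\<bar> powr p) \<partial>M) \<le>
      (\<integral>\<^sup>+ x. ennreal (\<theta> powr p) * indicator Y x + ennreal (2 powr p) *
         (ennreal (\<bar>u x\<bar> powr p) * indicator F x + ennreal (\<bar>v x\<bar> powr p) * indicator F x) \<partial>M)"
    proof (rule nn_integral_mono)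
      fix x assume x: "x \<in> space M"
      show "ennreal (\<bar>u x - v x\<bar> powr p) \<le> ennreal (\<theta> powr p) * indicator Y x + ennreal (2 powr p) *
         (ennreal (\<bar>u x\<bar> powr p) * indicator F x + ennreal (\<bar>v x\<bar> powr p) * indicator F x)"
      proof (cases "x \<in> F")
        case True
        have "\<bar>u x - v x\<bar> powr p \<le> (\<bar>u x\<bar> + \<bar>v x\<bar>) powr p"
          using \<open>0 < p\<close> by (intro powr_mono2) auto
        also have "\<dots> \<le> 2 powr p * (\<bar>u x\<bar> powr p + \<bar>v x\<bar> powr p)"
          using \<open>0 < p\<close> by (intro powr_add_le) auto
        finally have "ennreal (\<bar>u x - v x\<bar> powr p)
            \<le> ennreal (2 powr p * (\<bar>u x\<bar> powr p + \<bar>v x\<bar> powr p))"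
          by (rule ennreal_leI)
        then show ?thesis using True by (simp add: ennreal_mult ennreal_plus add_increasing)
      next
        case False
        then have "x \<in> Y" "\<bar>u x - v x\<bar> \<le> \<theta>" using x close by (auto simp: F_def)
        then show ?thesis using False \<open>0 < p\<close> by (auto intro!: ennreal_leI powr_mono2)
      qed
    qed
    also have "\<dots> = ennreal (\<theta> powr p) * ennreal m + ennreal (2 powr p) *
       ((\<integral>\<^sup>+ x. ennreal (\<bar>u x\<bar> powr p) * indicator F x \<partial>M)
        + (\<integral>\<^sup>+ x. ennreal (\<bar>v x\<bar> powr p) * indicator F x \<partial>M))"
      by (simp add: nn_integral_add nn_integral_cmult nn_integral_cmult_indicator m)
    also have "\<dots> \<le> ennreal (\<theta> powr p) * ennreal m + ennreal (2 powr p) * (ennreal E + ennreal E)"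
      using tail u v by (intro add_left_mono mult_left_mono add_mono) auto
    also have "\<dots> = ennreal (\<theta> powr p * m + 2 powr p * (2 * E))"
      using m E0 by (simp add: ennreal_plus ennreal_mult flip: mult_2)
    also have "\<dots> < ennreal (\<epsilon> powr p)"
    proof -
      have "2 powr p * (2 * E) = K1 * r powr (\<alpha> * p) + K2 * (4 * \<delta>)"
        by (simp add: E_def K1_def K2_def algebra_simps)
      then have "\<theta> powr p * m + 2 powr p * (2 * E) < 3 * e"
        using \<theta> \<delta> r_small by linarith
      then show ?thesis using m E0 by (subst ennreal_less_iff) (auto simp: e_def)
    qed
    finally show "(\<integral>\<^sup>+ x. ennreal (\<bar>u x - v x\<bar> powr p) \<partial>M) < ennreal (\<epsilon> powr p)" .
  qed
  have "\<exists>v\<in>K. Lp_norm M p (\<lambda>x. u x - v x) < ennreal \<epsilon>" if u: "u \<in> S" for u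
  proof -
    obtain v where v: "v \<in> K" "\<forall>x\<in>\<Union>\<Q> \<inter> G u \<inter> G v. \<bar>u x - v x\<bar> \<le> 2 * (\<theta> / 2)"
      using net(3)[OF u] by (rule bexE)
    have "Lp_norm M p (\<lambda>x. u x - v x) < ennreal \<epsilon>"
    proof (rule Lp_close[OF u])
      show "v \<in> S" using v(1) net(2) by (rule rev_subsetD)
      show "\<bar>u x - v x\<bar> \<le> \<theta>" if "x \<in> \<Union>\<Q> \<inter> G u \<inter> G v" for x
        using bspec[OF v(2) that] by simp
    qed
    then show ?thesis using v(1) by (rule bexI)
  qed
  then show "\<exists>K. finite K \<and> K \<subseteq> S \<and> (\<forall>u\<in>S. \<exists>v\<in>K. Lp_norm M p (\<lambda>x. u x - v x) < ennreal \<epsilon>)"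
    using net(1,2) by (intro exI[of _ K] conjI ballI)
qed

end

text \<open>A norm bound \<open>R0\<close> on the family yields a gradient of norm below any \<open>R > R0\<close> for each function, as
  the norm contains an infimum over gradients.\<close>

theorem theorem1p1:
  fixes M :: "'a measure" and d :: "'a \<Rightarrow> 'a \<Rightarrow> real" and \<alpha> p :: real
  assumes "quasi_metric_measure_space M d"
    and "\<And>r. 0 < r \<Longrightarrow> (\<lambda>x. emeasure M (qball (space M) d x r)) \<in> borel_measurable M"
    and "\<And>r. 0 < r \<Longrightarrow> (\<integral>\<^sup>+ x. 1 / emeasure M (qball (space M) d x r) \<partial>M) < \<infinity>"
    and "0 < \<alpha>" and "0 < p"
  shows "compact_embedding
           (hajlasz_space M d \<alpha> p) (hajlasz_norm M d \<alpha> p)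
           (Lp_space M p) (Lp_norm M p)"
proof -
  interpret quasi_metric_measure_space M d by fact
  have w: "inverse_ball_measure r \<in> borel_measurable M" if "0 < r" for r
    unfolding inverse_ball_measure_def using assms(2)[OF that] by measurable
  have "qnorm_totally_bounded (Lp_norm M p) S"
    if S: "S \<subseteq> hajlasz_space M d \<alpha> p" and bdd: "qnorm_bounded (hajlasz_norm M d \<alpha> p) S" for S
  proof -
    obtain R0 where R0: "\<And>u. u \<in> S \<Longrightarrow> hajlasz_norm M d \<alpha> p u \<le> ennreal R0"
      using bdd unfolding qnorm_bounded_def by blast
    define R where "R = max R0 0 + 1"
    have R: "0 \<le> R" "ennreal R0 < ennreal R" by (auto simp: R_def ennreal_less_iff max_def)
    have u_le: "Lp_norm M p u \<le> ennreal R" if "u \<in> S" for u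
    proof -
      have "Lp_norm M p u \<le> hajlasz_norm M d \<alpha> p u" by (simp add: hajlasz_norm_def)
      then show ?thesis using R0[OF that] R by (meson less_imp_le order_trans)
    qed
    have "\<exists>g. g \<in> hajlasz_gradients M d \<alpha> u \<and> Lp_norm M p g < ennreal R" if "u \<in> S" for u
    proof -
      have "(INF g \<in> hajlasz_gradients M d \<alpha> u. Lp_norm M p g) \<le> hajlasz_norm M d \<alpha> p u"
        by (simp add: hajlasz_norm_def)
      then have "(INF g \<in> hajlasz_gradients M d \<alpha> u. Lp_norm M p g) < ennreal R"
        using R0[OF that] R by (meson le_less_trans)
      then show ?thesis by (auto simp: INF_less_iff)
    qed
    then obtain g where g: "\<And>u. u \<in> S \<Longrightarrow> g u \<in> hajlasz_gradients M d \<alpha> u"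
      "\<And>u. u \<in> S \<Longrightarrow> Lp_norm M p (g u) < ennreal R" by metis
    have "\<exists>N. N \<in> null_sets M \<and> (\<forall>x\<in>space M - N. \<forall>y\<in>space M - N.
        \<bar>u x - u y\<bar> \<le> d x y powr \<alpha> * (g u x + g u y))" if "u \<in> S" for u
      using g(1)[OF that] unfolding hajlasz_gradients_def by blast
    then obtain N where N: "\<And>u. u \<in> S \<Longrightarrow> N u \<in> null_sets M"
      "\<And>u. u \<in> S \<Longrightarrow> \<forall>x\<in>space M - N u. \<forall>y\<in>space M - N u.
        \<bar>u x - u y\<bar> \<le> d x y powr \<alpha> * (g u x + g u y)" by metis
    show ?thesis
    proof (rule uniform_hajlasz_totally_bounded[where \<alpha> = \<alpha> and A = "R powr p" and g = g and N = N])
      show "(\<integral>\<^sup>+ x. inverse_ball_measure r x \<partial>M) < \<infinity>" if "0 < r" for r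
        unfolding inverse_ball_measure_def using assms(3)[OF that] .
      show "(\<integral>\<^sup>+ x. ennreal (\<bar>u x\<bar> powr p) \<partial>M) \<le> ennreal (R powr p)" if "u \<in> S" for u
        using u_le[OF that] R \<open>0 < p\<close> by (intro nn_integral_powr_le_of_Lp_norm_le)
      show "(\<integral>\<^sup>+ x. ennreal (\<bar>g u x\<bar> powr p) \<partial>M) \<le> ennreal (R powr p)" if "u \<in> S" for u
        using g(2)[OF that] R \<open>0 < p\<close> by (intro nn_integral_powr_le_of_Lp_norm_le) auto
    next
      fix u assume "u \<in> S"
      then show "u \<in> borel_measurable M"
        using S by (auto simp: hajlasz_space_def Lp_space_def)
      show "g u \<in> borel_measurable M" using g(1)[OF \<open>u \<in> S\<close>] by (simp add: hajlasz_gradients_def)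
    next
      fix u x assume "u \<in> S" "x \<in> space M"
      then show "0 \<le> g u x" using g(1)[of u] by (simp add: hajlasz_gradients_def)
    qed (use w N assms(4,5) in auto)
  qed
  moreover have "hajlasz_space M d \<alpha> p \<subseteq> Lp_space M p" by (auto simp: hajlasz_space_def)
  moreover have "Lp_norm M p f = 0" if "hajlasz_norm M d \<alpha> p f = 0" for f
    using that by (simp add: hajlasz_norm_def)
  ultimately show ?thesis unfolding compact_embedding_def by blast
qed

end
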